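(* Assume that $\lim_{|x|\to0}\frac{|Q(x)|}{|x|}=0$. Suppose the following semi-definite program is feasible, and let $P_1\in\mathbb S^{n\times n}$, $Y_1\in\mathbb R^{T\times n}$, $G_2\in\mathbb R^{T\times(S-n)}$ be a feasible point: minimize $\|X_1G_2\|$ (any norm) subject to $$Z_0Y_1=\begin{bmatrix}P_1\\ 0_{(S-n)\times n}\end{bmatrix},\qquad \begin{bmatrix}P_1&(X_1Y_1)^\top\\ X_1Y_1&P_1\end{bmatrix}\succ0,\qquad Z_0G_2=\begin{bmatrix}0_{n\times(S-n)}\\ I_{S-n}\end{bmatrix}.$$ Apply the control law $u=KZ(x)$ with $K=U_0\begin{bmatrix}Y_1P_1^{-1}&G_2\end{bmatrix}$. Set $M:=X_1Y_1P_1^{-1}$, $N:=X_1G_2$, $$h(x):=(Mx+NQ(x))^\top P_1^{-1}(Mx+NQ(x))-x^\top P_1^{-1}x,$$ $\mathcal V:=\{x:h(x)<0\}$, and consider the Lyapunov function $V(x):=x^\top P_1^{-1}x$. Then any sub-level set $\mathcal R_\gamma:=\{x:V(x)\le\gamma\}$ of $V$ contained in $\mathcal V\cup\{0\}$ is a positively invariant set for the closed-loop system $x^+=AZ(x)+BKZ(x)$ and defines an estimate of the region of attraction relative to the equilibrium $\overline x=0$.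
   Context: Let $n,m,S,T$ be positive integers with $S\ge n$ (blocks of zero size are absent when $S=n$). Consider the discrete-time system $x^+=AZ(x)+Bu$, i.e. $x(t+1)=AZ(x(t))+Bu(t)$, with $x\in\mathbb R^n$, $u\in\mathbb R^m$, constant matrices $A\in\mathbb R^{n\times S}$, $B\in\mathbb R^{n\times m}$ (unknown to the designer), and $Z(x)=\begin{bmatrix}x\\ Q(x)\end{bmatrix}$ with a known function $Q:\mathbb R^n\to\mathbb R^{S-n}$ containing only nonlinear functions. Data: samples $x(0),\dots,x(T)\in\mathbb R^n$, $u(0),\dots,u(T-1)\in\mathbb R^m$ satisfying $x(k+1)=AZ(x(k))+Bu(k)$ for $k=0,\dots,T-1$. Define $U_0=[u(0)\ \cdots\ u(T-1)]\in\mathbb R^{m\times T}$, $X_1=[x(1)\ \cdots\ x(T)]\in\mathbb R^{n\times T}$, $Z_0=[Z(x(0))\ \cdots\ Z(x(T-1))]\in\mathbb R^{S\times T}$. A set $\mathcal S$ is positively invariant for $x^+=f(x)$ if for every $x(0)\in\mathcal S$ the solution satisfies $x(t)\in\mathcal S$ for $t>0$. For an asymptotically stable equilibrium $\overline x$ of $x^+=f(x)$, a set $\mathcal R$ defines a region of attraction relative to $\overline x$ if for every $x(0)\in\mathcal R$ we have $\lim_{t\to\infty}x(t)=\overline x$. $\mathbb S^{n\times n}$ is the set of real symmetric $n\times n$ matrices; $\succ0$ means positive definite; $|\cdot|$ is the Euclidean norm.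
   Formalization: The formal statement additionally assumes that Q is continuous; without this Q(0) need not be 0, and even with Q(0)=0 a discontinuous Q can make trajectories in a sub-level set inside V∪{0} converge to a nonzero point. *)

theory Defs
  imports
    "HOL-Analysis.Abstract_Metric_Spaces"
    "HOL-Analysis.L2_Norm"
    "Jordan_Normal_Form.Gauss_Jordan_Elimination"
begin

text \<open>
  Dimensions are natural numbers and matrices are those of Jordan_Normal_Form, so that blocks of
  size zero (a state lift without nonlinear part) are genuine objects. Euclidean \<open>n\<close>-space is
  \<^term>\<open>carrier_vec n\<close>.
\<close>

subsection \<open>Euclidean structure on \<open>carrier_vec n\<close>\<close>

definition eucl_norm :: "real vec \<Rightarrow> real" where
  "eucl_norm v = L2_set (\<lambda>i. v $ i) {0..<dim_vec v}"

text \<open>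
  The dimension is a parameter because \<^locale>\<open>Metric_space\<close> wants symmetry also for arguments
  outside the carrier.
\<close>

definition eucl_dist :: "nat \<Rightarrow> real vec \<Rightarrow> real vec \<Rightarrow> real" where
  "eucl_dist n v w = L2_set (\<lambda>i. v $ i - w $ i) {0..<n}"

lemma eucl_dist_eq_norm:
  assumes "v \<in> carrier_vec n" "w \<in> carrier_vec n"
  shows "eucl_dist n v w = eucl_norm (v - w)"
  using assms unfolding eucl_dist_def eucl_norm_def by (intro L2_set_cong) auto

lemma eucl_norm_eq_sqrt: "eucl_norm v = sqrt (v \<bullet> v)"
  by (simp add: eucl_norm_def L2_set_def scalar_prod_def power2_eq_square)

lemma Metric_space_eucl: "Metric_space (carrier_vec n) (eucl_dist n)"
proof
  fix x y z :: "real vec"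
  show "0 \<le> eucl_dist n x y" by (simp add: eucl_dist_def)
  show "eucl_dist n x y = eucl_dist n y x"
    by (simp add: eucl_dist_def L2_set_def power2_commute)
  show "eucl_dist n x y = 0 \<longleftrightarrow> x = y" if "x \<in> carrier_vec n" "y \<in> carrier_vec n"
    using that by (auto simp: eucl_dist_def L2_set_eq_0_iff intro!: eq_vecI)
  show "eucl_dist n x z \<le> eucl_dist n x y + eucl_dist n y z"
    using L2_set_triangle_ineq[of "\<lambda>i. x $ i - y $ i" "\<lambda>i. y $ i - z $ i" "{0..<n}"]
    by (simp add: eucl_dist_def)
qed

definition eucl_top :: "nat \<Rightarrow> real vec topology" where
  "eucl_top n = Metric_space.mtopology (carrier_vec n) (eucl_dist n)"

lemma topspace_eucl_top [simp]: "topspace (eucl_top n) = carrier_vec n"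
  unfolding eucl_top_def by (rule Metric_space.topspace_mtopology[OF Metric_space_eucl])

subsection \<open>Matrices\<close>

definition append_cols :: "real mat \<Rightarrow> real mat \<Rightarrow> real mat" where
  "append_cols A B = four_block_mat A B (0\<^sub>m 0 (dim_col A)) (0\<^sub>m 0 (dim_col B))"

text \<open>Unspecified for singular matrices.\<close>

definition inv_mat :: "real mat \<Rightarrow> real mat" where
  "inv_mat A = the (mat_inverse A)"

definition symmetric_mat :: "nat \<Rightarrow> real mat \<Rightarrow> bool" where
  "symmetric_mat n A \<longleftrightarrow> A \<in> carrier_mat n n \<and> transpose_mat A = A"

definition pos_def_mat :: "nat \<Rightarrow> real mat \<Rightarrow> bool" where
  "pos_def_mat n A \<longleftrightarrow> symmetric_mat n A \<and>
     (\<forall>v \<in> carrier_vec n. v \<noteq> 0\<^sub>v n \<longrightarrow> v \<bullet> (A *\<^sub>v v) > 0)"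

text \<open>\<open>sample_mat d T v\<close> has the columns \<open>v 0, \<dots>, v (T - 1)\<close> of length \<open>d\<close>.\<close>

definition sample_mat :: "nat \<Rightarrow> nat \<Rightarrow> (nat \<Rightarrow> real vec) \<Rightarrow> real mat" where
  "sample_mat d T v = mat_of_cols d (map v [0..<T])"

subsection \<open>Discrete-time systems\<close>

text \<open>
  The solution of the system with right-hand side \<open>f\<close> and initial state \<open>x0\<close> is
  \<open>\<lambda>t. (f ^^ t) x0\<close>.
\<close>

definition positively_invariant :: "(real vec \<Rightarrow> real vec) \<Rightarrow> real vec set \<Rightarrow> bool" where
  "positively_invariant f R \<longleftrightarrow> (\<forall>x0 \<in> R. \<forall>t > 0. (f ^^ t) x0 \<in> R)"

definition equilibrium :: "nat \<Rightarrow> (real vec \<Rightarrow> real vec) \<Rightarrow> real vec \<Rightarrow> bool" where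
  "equilibrium n f xb \<longleftrightarrow> xb \<in> carrier_vec n \<and> f xb = xb"

definition solution_tendsto ::
    "nat \<Rightarrow> (real vec \<Rightarrow> real vec) \<Rightarrow> real vec \<Rightarrow> real vec \<Rightarrow> bool" where
  "solution_tendsto n f x0 xb \<longleftrightarrow> limitin (eucl_top n) (\<lambda>t. (f ^^ t) x0) xb sequentially"

definition lyapunov_stable :: "nat \<Rightarrow> (real vec \<Rightarrow> real vec) \<Rightarrow> real vec \<Rightarrow> bool" where
  "lyapunov_stable n f xb \<longleftrightarrow>
     (\<forall>\<epsilon> > 0. \<exists>\<delta> > 0. \<forall>x0 \<in> carrier_vec n. eucl_dist n x0 xb < \<delta> \<longrightarrow>
        (\<forall>t. eucl_dist n ((f ^^ t) x0) xb < \<epsilon>))"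

definition locally_attractive :: "nat \<Rightarrow> (real vec \<Rightarrow> real vec) \<Rightarrow> real vec \<Rightarrow> bool" where
  "locally_attractive n f xb \<longleftrightarrow>
     (\<exists>\<delta> > 0. \<forall>x0 \<in> carrier_vec n. eucl_dist n x0 xb < \<delta> \<longrightarrow> solution_tendsto n f x0 xb)"

definition asymptotically_stable :: "nat \<Rightarrow> (real vec \<Rightarrow> real vec) \<Rightarrow> real vec \<Rightarrow> bool" where
  "asymptotically_stable n f xb \<longleftrightarrow>
     equilibrium n f xb \<and> lyapunov_stable n f xb \<and> locally_attractive n f xb"

text \<open>
  \<open>R\<close> is an estimate of the basin: it need not be the whole set of attracted states.
\<close>

definition region_of_attraction ::
    "nat \<Rightarrow> (real vec \<Rightarrow> real vec) \<Rightarrow> real vec \<Rightarrow> real vec set \<Rightarrow> bool" where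
  "region_of_attraction n f xb R \<longleftrightarrow> asymptotically_stable n f xb \<and> R \<subseteq> carrier_vec n \<and>
     (\<forall>x0 \<in> R. solution_tendsto n f x0 xb)"

subsection \<open>The constraints of the semi-definite program\<close>

text \<open>The data matrices are \<open>X1\<close> (\<open>n \<times> T\<close>) and \<open>Z0\<close> (\<open>S \<times> T\<close>).\<close>

definition sdp_feasible ::
    "nat \<Rightarrow> nat \<Rightarrow> nat \<Rightarrow> real mat \<Rightarrow> real mat \<Rightarrow> real mat \<Rightarrow> real mat \<Rightarrow> real mat \<Rightarrow> bool" where
  "sdp_feasible n S T X1 Z0 P1 Y1 G2 \<longleftrightarrow>
     symmetric_mat n P1 \<and> Y1 \<in> carrier_mat T n \<and> G2 \<in> carrier_mat T (S - n) \<and>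
     Z0 * Y1 = P1 @\<^sub>r 0\<^sub>m (S - n) n \<and>
     pos_def_mat (n + n) (four_block_mat P1 (transpose_mat (X1 * Y1)) (X1 * Y1) P1) \<and>
     Z0 * G2 = 0\<^sub>m n (S - n) @\<^sub>r 1\<^sub>m (S - n)"

end

theory Submission
  imports Defs "Jordan_Normal_Form.Determinant"
begin

text \<open>
  The data matrices satisfy \<open>X1 = A Z0 + B U0\<close>, and the equality constraints make
  \<open>[Y1 P1\<inverse>, G2]\<close> a right inverse of \<open>Z0\<close>; hence the closed loop is
  \<open>f v = M v + N Q v\<close>, without reference to \<open>A\<close> and \<open>B\<close>. The Schur complement of the block
  constraint says \<open>V (M v) < V v\<close> for \<open>v \<noteq> 0\<close>, by compactness with a margin \<open>\<beta> |v|\<^sup>2\<close>, which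
  absorbs the perturbation \<open>N Q v = o(|v|)\<close> near the origin. So \<open>V\<close> strictly decreases on some
  small sublevel set as well as on every sublevel set contained in \<open>W \<union> {0}\<close>. On such a set the
  decrease is bounded away from zero outside each neighbourhood of the origin, again by compactness,
  so trajectories converge to \<open>0\<close>.
\<close>

subsection \<open>Topology of \<open>carrier_vec n\<close>\<close>

unbundle no inner_syntax and no vec_syntax

interpretation eucl: Metric_space "carrier_vec n" "eucl_dist n" for n
  by (rule Metric_space_eucl)

section \<open>Norm estimates: scaling, Cauchy-Schwarz and bounds for matrices\<close>

lemma eucl_dist_zero: "v \<in> carrier_vec n \<Longrightarrow> eucl_dist n v (0\<^sub>v n) = eucl_norm v"
  by (auto simp: eucl_dist_def eucl_norm_def intro: L2_set_cong)

lemma eucl_norm_nonneg [simp]: "0 \<le> eucl_norm v"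
  by (simp add: eucl_norm_def)

lemma eucl_norm_eq_0_iff: "v \<in> carrier_vec n \<Longrightarrow> eucl_norm v = 0 \<longleftrightarrow> v = 0\<^sub>v n"
  by (auto simp: eucl_norm_def L2_set_eq_0_iff)

lemma scalar_prod_self: "v \<bullet> v = (eucl_norm v)\<^sup>2"
  by (simp add: eucl_norm_def L2_set_def scalar_prod_def sum_nonneg power2_eq_square)

lemma eucl_norm_smult: "eucl_norm (c \<cdot>\<^sub>v v) = \<bar>c\<bar> * eucl_norm v"
proof -
  have "(eucl_norm (c \<cdot>\<^sub>v v))\<^sup>2 = (\<bar>c\<bar> * eucl_norm v)\<^sup>2"
    by (simp add: scalar_prod_self[symmetric] power_mult_distrib) (simp add: power2_eq_square)
  thus ?thesis by (subst (asm) power2_eq_iff_nonneg) auto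
qed

lemma eucl_norm_cauchy_schwarz:
  assumes "v \<in> carrier_vec n" "w \<in> carrier_vec n"
  shows "\<bar>v \<bullet> w\<bar> \<le> eucl_norm v * eucl_norm w"
proof -
  have "\<bar>v \<bullet> w\<bar> \<le> (\<Sum>i\<in>{0..<n}. \<bar>v $ i\<bar> * \<bar>w $ i\<bar>)"
    using assms by (auto simp: scalar_prod_def abs_mult[symmetric] intro: sum_abs)
  also have "\<dots> \<le> eucl_norm v * eucl_norm w"
    using assms L2_set_mult_ineq[of "\<lambda>i. v $ i" "\<lambda>i. w $ i" "{0..<n}"]
    by (simp add: eucl_norm_def)
  finally show ?thesis .
qed

text \<open>The constant is the sum of the row norms: the Euclidean norm is at most the sum of the
  absolute entries, and Cauchy-Schwarz bounds each entry. This crude operator bound suffices for the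
  perturbation estimate.\<close>

lemma mult_mat_vec_norm_bound:
  assumes L: "L \<in> carrier_mat k n"
  obtains C where "C \<ge> 0" "\<And>v. v \<in> carrier_vec n \<Longrightarrow> eucl_norm (L *\<^sub>v v) \<le> C * eucl_norm v"
proof
  show "0 \<le> (\<Sum>i<k. eucl_norm (row L i))" by (simp add: sum_nonneg)
  fix v :: "real vec" assume v: "v \<in> carrier_vec n"
  have "eucl_norm (L *\<^sub>v v) \<le> (\<Sum>i<k. \<bar>row L i \<bullet> v\<bar>)"
    using L L2_set_le_sum_abs[of "\<lambda>i. (L *\<^sub>v v) $ i" "{..<k}"]
    by (simp add: eucl_norm_def lessThan_atLeast0)
  also have "\<dots> \<le> (\<Sum>i<k. eucl_norm (row L i) * eucl_norm v)"
    using L v by (intro sum_mono eucl_norm_cauchy_schwarz) auto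
  finally show "eucl_norm (L *\<^sub>v v) \<le> (\<Sum>i<k. eucl_norm (row L i)) * eucl_norm v"
    by (simp add: sum_distrib_right)
qed

section \<open>Continuity of maps into Euclidean space\<close>

lemma continuous_map_eucl_index:
  assumes "i < n"
  shows "continuous_map (eucl_top n) euclideanreal (\<lambda>v. v $ i)"
proof -
  have "\<bar>v $ i - w $ i\<bar> \<le> eucl_dist n v w" for v w :: "real vec"
    using assms member_le_L2_set[of "{0..<n}" i "\<lambda>i. \<bar>v $ i - w $ i\<bar>"]
    by (simp add: eucl_dist_def L2_set_def)
  hence "((\<lambda>v. v $ i) \<longlongrightarrow> w $ i) (atin (eucl_top n) w)" for w
    unfolding tendsto_iff eucl_top_def eucl.eventually_atin_metric dist_real_def
    using le_less_trans by blast
  thus ?thesis by (simp add: continuous_map_atin)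
qed

text \<open>Coordinates are continuous, which gives one direction. Conversely the distance is the
  root of a finite sum of squares, each of which tends to 0. This reduces continuity of
  vector-valued maps to real-valued ones.\<close>

lemma continuous_map_eucl_top_iff:
  "continuous_map X (eucl_top n) F \<longleftrightarrow>
     F \<in> topspace X \<rightarrow> carrier_vec n \<and> (\<forall>i<n. continuous_map X euclideanreal (\<lambda>x. F x $ i))"
  (is "?l \<longleftrightarrow> ?r")
proof
  assume F: ?l
  show ?r
    using continuous_map_funspace[OF F] continuous_map_compose[OF F continuous_map_eucl_index]
    by (auto simp: comp_def)
next
  assume F: ?r
  show ?l
    unfolding continuous_map_atin
  proof
    fix a assume a: "a \<in> topspace X"
    have "((\<lambda>x. F x $ i) \<longlongrightarrow> F a $ i) (atin X a)" if "i < n" for i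
      using F a that by (simp add: continuous_map_atin)
    hence "((\<lambda>x. \<Sum>i=0..<n. (F x $ i - F a $ i)\<^sup>2) \<longlongrightarrow> (\<Sum>i=0..<n. (F a $ i - F a $ i)\<^sup>2))
        (atin X a)"
      by (intro tendsto_intros) auto
    from tendsto_real_sqrt[OF this]
    have "((\<lambda>x. eucl_dist n (F x) (F a)) \<longlongrightarrow> 0) (atin X a)"
      by (simp add: eucl_dist_def L2_set_def)
    moreover have "eventually (\<lambda>x. F x \<in> carrier_vec n) (atin X a)"
      using F a by (auto simp: eventually_atin Pi_iff intro!: exI[of _ "topspace X"])
    ultimately show "limitin (eucl_top n) F (F a) (atin X a)"
      using F a unfolding eucl_top_def by (auto simp: eucl.limitin_metric_dist_null)
  qed
qed

lemma continuous_map_eucl_carrier: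
  "continuous_map X (eucl_top n) F \<Longrightarrow> x \<in> topspace X \<Longrightarrow> F x \<in> carrier_vec n"
  by (auto simp: continuous_map_eucl_top_iff)

lemma continuous_map_scalar_prod:
  assumes "continuous_map X (eucl_top n) F" "continuous_map X (eucl_top n) G"
  shows "continuous_map X euclideanreal (\<lambda>x. F x \<bullet> G x)"
proof -
  have "continuous_map X euclideanreal (\<lambda>x. \<Sum>i=0..<n. F x $ i * G x $ i)"
    using assms unfolding continuous_map_eucl_top_iff
    by (intro continuous_map_sum continuous_map_real_mult) auto
  \<comment> \<open>\<open>scalar_prod\<close> sums up to the dimension of its second argument,
    which is known to be \<open>n\<close> only on the topological space \<open>X\<close>; hence
    equality is claimed there only.\<close>
  thus ?thesis
    by (rule continuous_map_eq)
      (use assms(2)[THEN continuous_map_eucl_carrier, THEN carrier_vecD] in \<open>simp add: scalar_prod_def\<close>)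
qed

lemma continuous_map_mult_mat_vec:
  assumes "L \<in> carrier_mat k n" "continuous_map X (eucl_top n) F"
  shows "continuous_map X (eucl_top k) (\<lambda>x. L *\<^sub>v F x)"
  unfolding continuous_map_eucl_top_iff
proof (intro conjI allI impI)
  show "(\<lambda>x. L *\<^sub>v F x) \<in> topspace X \<rightarrow> carrier_vec k"
    using assms(1) continuous_map_eucl_carrier[OF assms(2)] by auto
  fix i assume i: "i < k"
  have "continuous_map X (eucl_top n) (\<lambda>x. row L i)"
    using assms i by (simp add: row_carrier_vec[of _ k])
  from continuous_map_scalar_prod[OF this assms(2)]
  show "continuous_map X euclideanreal (\<lambda>x. (L *\<^sub>v F x) $ i)"
    using assms i by simp
qed

lemma continuous_map_add_vec:
  assumes "continuous_map X (eucl_top n) F" "continuous_map X (eucl_top n) G"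
  shows "continuous_map X (eucl_top n) (\<lambda>x. F x + G x)"
  unfolding continuous_map_eucl_top_iff
proof (intro conjI allI impI)
  show "(\<lambda>x. F x + G x) \<in> topspace X \<rightarrow> carrier_vec n"
    using assms[THEN continuous_map_eucl_carrier] by auto
  fix i assume i: "i < n"
  have "continuous_map X euclideanreal (\<lambda>x. F x $ i + G x $ i)"
    using assms i by (intro continuous_map_add) (auto simp: continuous_map_eucl_top_iff)
  thus "continuous_map X euclideanreal (\<lambda>x. (F x + G x) $ i)"
    by (rule continuous_map_eq) (use assms(2)[THEN continuous_map_eucl_carrier, THEN carrier_vecD] i in simp)
qed

section \<open>Compactness and attained minima\<close>

text \<open>By Tychonoff the sequences with values in [-r, r] form a compact set, and truncation to
  the first \<open>n\<close> entries is continuous and maps it onto the cube. The argument is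
  uniform in \<open>n\<close>, zero included.\<close>

lemma compactin_eucl_cube:
  assumes "0 \<le> r"
  shows "compactin (eucl_top n) {v \<in> carrier_vec n. \<forall>i<n. \<bar>v $ i\<bar> \<le> r}"
proof -
  let ?K = "PiE UNIV (\<lambda>_. {-r..r}) :: (nat \<Rightarrow> real) set"
  have "compactin (product_topology (\<lambda>i. euclideanreal) UNIV) ?K"
    by (subst compactin_PiE) auto
  hence "compactin euclidean ?K"
    by (simp add: euclidean_product_topology)
  moreover have "continuous_map euclidean (eucl_top n) (\<lambda>a. vec n a)"
    by (auto simp: continuous_map_eucl_top_iff)
  ultimately have "compactin (eucl_top n) ((\<lambda>a. vec n a) ` ?K)"
    by (rule image_compactin)
  moreover have "(\<lambda>a. vec n a) ` ?K = {v \<in> carrier_vec n. \<forall>i<n. \<bar>v $ i\<bar> \<le> r}"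
  proof (intro equalityI subsetI)
    fix v assume v: "v \<in> {v \<in> carrier_vec n. \<forall>i<n. \<bar>v $ i\<bar> \<le> r}"
    \<comment> \<open>The preimage continues \<open>v\<close> by 0, a value in the interval because
      \<open>r\<close> is nonnegative.\<close>
    thus "v \<in> (\<lambda>a. vec n a) ` ?K" using assms
      by (intro image_eqI[of _ _ "\<lambda>i. if i < n then v $ i else 0"]) (auto simp: abs_le_iff)
  qed (auto simp: abs_le_iff PiE_iff minus_le_iff)
  ultimately show ?thesis by simp
qed

text \<open>One half of Heine-Borel: a norm bound also bounds every entry, so \<open>K\<close> is a
  closed subset of a compact cube.\<close>

lemma compactin_eucl_closed_bounded:
  assumes "closedin (eucl_top n) K" "\<And>v. v \<in> K \<Longrightarrow> eucl_norm v \<le> r"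
  shows "compactin (eucl_top n) K"
proof (rule closed_compactin[OF compactin_eucl_cube _ assms(1)])
  \<comment> \<open>The absolute value covers a negative \<open>r\<close>, for which
    \<open>K\<close> is empty; the cube needs a nonnegative size.\<close>
  show "K \<subseteq> {v \<in> carrier_vec n. \<forall>i<n. \<bar>v $ i\<bar> \<le> \<bar>r\<bar>}"
  proof (intro subsetI CollectI conjI allI impI)
    fix v assume v: "v \<in> K"
    thus c: "v \<in> carrier_vec n" using closedin_subset[OF assms(1)] by auto
    fix i assume "i < n"
    hence "\<bar>v $ i\<bar> \<le> eucl_norm v"
      using c member_le_L2_set[of "{0..<n}" i "\<lambda>i. \<bar>v $ i\<bar>"] by (simp add: eucl_norm_def L2_set_def)
    thus "\<bar>v $ i\<bar> \<le> \<bar>r\<bar>" using assms(2)[OF v] by linarith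
  qed
qed simp

lemma compactin_attains_inf:
  assumes "compactin X K" "K \<noteq> {}" "continuous_map X euclideanreal \<phi>"
  obtains v where "v \<in> K" "\<And>w. w \<in> K \<Longrightarrow> \<phi> v \<le> \<phi> w"
proof -
  have "compact (\<phi> ` K)" using image_compactin[OF assms(1,3)] by simp
  from compact_attains_inf[OF this] show ?thesis using assms(2) that by auto
qed

lemma continuous_map_eucl_ident: "continuous_map (eucl_top n) (eucl_top n) (\<lambda>v. v)"
  by (simp add: continuous_map_id[unfolded id_def])

lemma continuous_map_eucl_norm:
  assumes "continuous_map X (eucl_top n) F"
  shows "continuous_map X euclideanreal (\<lambda>x. eucl_norm (F x))"
proof -
  have "continuous_map X euclideanreal (sqrt \<circ> (\<lambda>x. F x \<bullet> F x))"
    by (intro continuous_map_compose[OF continuous_map_scalar_prod[OF assms assms]])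
      (simp add: continuous_on_real_sqrt continuous_on_id)
  thus ?thesis by (simp add: comp_def eucl_norm_eq_sqrt)
qed

text \<open>The constant is the minimum of \<open>q\<close> on the unit sphere, attained by
  compactness and hence positive; homogeneity carries the bound to all vectors.\<close>

lemma pos_homogeneous_quadratic_bound:
  assumes cont: "continuous_map (eucl_top n) euclideanreal q"
    and hom: "\<And>c v. v \<in> carrier_vec n \<Longrightarrow> q (c \<cdot>\<^sub>v v) = c\<^sup>2 * q v"
    and pos: "\<And>v. v \<in> carrier_vec n \<Longrightarrow> v \<noteq> 0\<^sub>v n \<Longrightarrow> q v > 0"
  obtains \<alpha> where "\<alpha> > 0" "\<And>v. v \<in> carrier_vec n \<Longrightarrow> \<alpha> * (eucl_norm v)\<^sup>2 \<le> q v"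
proof -
  let ?K = "{v \<in> carrier_vec n. eucl_norm v \<in> {1}}"
  have cl: "closedin (eucl_top n) ?K"
    using closedin_continuous_map_preimage[OF continuous_map_eucl_norm[OF continuous_map_eucl_ident],
      of "{1}" n]
    by simp
  have K: "compactin (eucl_top n) ?K"
    by (rule compactin_eucl_closed_bounded[OF cl, of 1]) simp
  have q0: "q (0\<^sub>v n) = 0"
  proof -
    have "0 \<cdot>\<^sub>v 0\<^sub>v n = (0\<^sub>v n :: real vec)" by (rule eq_vecI) auto
    thus ?thesis using hom[of "0\<^sub>v n" 0] by simp
  qed
  have unit: "(1 / eucl_norm v) \<cdot>\<^sub>v v \<in> ?K" if "v \<in> carrier_vec n" "v \<noteq> 0\<^sub>v n" for v
    using that eucl_norm_eq_0_iff[of v n] by (simp add: eucl_norm_smult)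
  show ?thesis
  proof (cases "?K = {}")
    \<comment> \<open>The sphere is empty only in dimension 0. Then the origin is the only vector
      and any positive constant works.\<close>
    case True
    hence "v = 0\<^sub>v n" if "v \<in> carrier_vec n" for v :: "real vec" using unit[OF that] by fast
    moreover have "eucl_norm (0\<^sub>v n) = 0" using eucl_norm_eq_0_iff[of "0\<^sub>v n" n] by simp
    ultimately have "1 * (eucl_norm v)\<^sup>2 \<le> q v" if "v \<in> carrier_vec n" for v
      using q0 that by simp
    thus ?thesis by (intro that[of 1]) simp_all
  next
    case False
    obtain a where a: "a \<in> ?K" "\<And>w. w \<in> ?K \<Longrightarrow> q a \<le> q w"
      using compactin_attains_inf[OF K False cont] by blast
    have "0 < q a" using a(1) pos[of a] eucl_norm_eq_0_iff[of "0\<^sub>v n" n] by force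
    moreover have "q a * (eucl_norm v)\<^sup>2 \<le> q v" if v: "v \<in> carrier_vec n" for v
    proof (cases "v = 0\<^sub>v n")
      case True
      thus ?thesis using q0 eucl_norm_eq_0_iff[of v n] v by simp
    next
      case False
      hence "0 < eucl_norm v" using eucl_norm_eq_0_iff[OF v] eucl_norm_nonneg[of v] by linarith
      moreover have "q a \<le> (1 / eucl_norm v)\<^sup>2 * q v"
        using a(2)[OF unit[OF v False]] hom[OF v] by simp
      ultimately show ?thesis by (simp add: field_simps)
    qed
    ultimately show ?thesis by (rule that)
  qed
qed

text \<open>The filter \<open>atin\<close> controls a punctured ball; at the origin itself the
  difference is 0.\<close>

lemma eucl_continuous_at_zero:
  assumes "continuous_map (eucl_top n) euclideanreal \<phi>" "e > 0"
  obtains \<delta> where "\<delta> > 0"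
    "\<And>v. v \<in> carrier_vec n \<Longrightarrow> eucl_norm v < \<delta> \<Longrightarrow> \<bar>\<phi> v - \<phi> (0\<^sub>v n)\<bar> < e"
proof -
  have "(\<phi> \<longlongrightarrow> \<phi> (0\<^sub>v n)) (atin (eucl_top n) (0\<^sub>v n))"
    using assms(1) by (simp add: continuous_map_atin)
  from tendstoD[OF this assms(2)] obtain \<delta> where d: "\<delta> > 0"
    "\<forall>v. v \<in> carrier_vec n \<and> 0 < eucl_dist n v (0\<^sub>v n) \<and> eucl_dist n v (0\<^sub>v n) < \<delta>
      \<longrightarrow> \<bar>\<phi> v - \<phi> (0\<^sub>v n)\<bar> < e"
    by (auto simp: eucl_top_def eucl.eventually_atin_metric dist_real_def)
  show ?thesis
  proof (rule that[OF d(1)])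
    fix v assume v: "v \<in> carrier_vec n" "eucl_norm v < \<delta>"
    show "\<bar>\<phi> v - \<phi> (0\<^sub>v n)\<bar> < e"
    proof (cases "v = 0\<^sub>v n")
      case False
      hence "0 < eucl_norm v" using eucl_norm_eq_0_iff[OF v(1)] eucl_norm_nonneg[of v] by linarith
      thus ?thesis using d(2) v by (simp add: eucl_dist_zero)
    qed (simp add: assms)
  qed
qed

lemma solution_tendsto_zero_iff:
  assumes "\<And>t. (f ^^ t) x0 \<in> carrier_vec n"
  shows "solution_tendsto n f x0 (0\<^sub>v n) \<longleftrightarrow> (\<lambda>t. eucl_norm ((f ^^ t) x0)) \<longlonglongrightarrow> 0"
  using assms
  by (simp add: solution_tendsto_def eucl_top_def eucl.limitin_metric_dist_null eucl_dist_zero)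

subsection \<open>Lyapunov functions\<close>

text \<open>Decrease of \<open>V\<close> is kept out of the locale and tied to a level by
  \<open>decreasing_below\<close>, so that the same results serve a small level, for stability, and
  the given level \<gamma>, for attraction.\<close>

locale lyapunov_function =
  fixes n :: nat and f :: "real vec \<Rightarrow> real vec" and V :: "real vec \<Rightarrow> real" and \<alpha> :: real
  assumes f_cont: "continuous_map (eucl_top n) (eucl_top n) f"
    and V_cont: "continuous_map (eucl_top n) euclideanreal V"
    and f_zero: "f (0\<^sub>v n) = 0\<^sub>v n"
    and V_zero: "V (0\<^sub>v n) = 0"
    and \<alpha>_pos: "0 < \<alpha>"
    and V_lower: "\<And>v. v \<in> carrier_vec n \<Longrightarrow> \<alpha> * (eucl_norm v)\<^sup>2 \<le> V v"
begin

definition decreasing_below :: "real \<Rightarrow> bool" where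
  "decreasing_below \<gamma> \<longleftrightarrow> (\<forall>v \<in> carrier_vec n. V v \<le> \<gamma> \<longrightarrow> v \<noteq> 0\<^sub>v n \<longrightarrow> V (f v) < V v)"

lemma f_carrier: "v \<in> carrier_vec n \<Longrightarrow> f v \<in> carrier_vec n"
  using continuous_map_eucl_carrier[OF f_cont] by simp

lemma decreasing_below_le:
  assumes "decreasing_below \<gamma>" "v \<in> carrier_vec n" "V v \<le> \<gamma>"
  shows "V (f v) \<le> V v"
  using assms by (cases "v = 0\<^sub>v n") (auto simp: decreasing_below_def f_zero less_imp_le)

lemma sublevel_invariant:
  assumes "decreasing_below \<gamma>" "v \<in> carrier_vec n" "V v \<le> \<gamma>"
  shows "(f ^^ t) v \<in> carrier_vec n \<and> V ((f ^^ t) v) \<le> \<gamma>"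
proof (induction t)
  case (Suc t)
  thus ?case using decreasing_below_le[OF assms(1), of "(f ^^ t) v"] f_carrier by auto
qed (use assms in auto)

text \<open>If \<open>V\<close> stayed above some \<epsilon> > 0 along the trajectory, every step
  would lower it by at least the positive minimum of \<open>V w - V (f w)\<close> over a compact
  shell, and \<open>V\<close> would finally fall below \<epsilon>. Hence \<open>V\<close> becomes
  arbitrarily small, stays so by monotonicity, and controls the norm through
  \<open>V_lower\<close>.\<close>

lemma sublevel_attracted:
  assumes dec: "decreasing_below \<gamma>" and v: "v \<in> carrier_vec n" "V v \<le> \<gamma>"
  shows "solution_tendsto n f v (0\<^sub>v n)"
proof -
  let ?x = "\<lambda>t. (f ^^ t) v"
  have x: "?x t \<in> carrier_vec n" "V (?x t) \<le> \<gamma>" for t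
    using sublevel_invariant[OF assms] by auto
  have "decseq (\<lambda>t. V (?x t))"
    using decreasing_below_le[OF dec x] by (intro decseq_SucI) simp
  have reach: "\<exists>t. V (?x t) < \<epsilon>" if e: "\<epsilon> > 0" for \<epsilon>
  proof (rule ccontr)
    assume "\<not> ?thesis"
    hence above: "\<epsilon> \<le> V (?x t)" for t by (simp add: not_less)
    \<comment> \<open>The shell contains the whole trajectory and excludes the origin; the lower
      bound on \<open>V\<close> makes it bounded.\<close>
    let ?K = "{w \<in> carrier_vec n. V w \<in> {\<epsilon>..\<gamma>}}"
    have cl: "closedin (eucl_top n) ?K"
      using closedin_continuous_map_preimage[OF V_cont, of "{\<epsilon>..\<gamma>}"] by simp
    have "compactin (eucl_top n) ?K"
    proof (rule compactin_eucl_closed_bounded[OF cl])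
      fix w assume "w \<in> ?K"
      hence "\<alpha> * (eucl_norm w)\<^sup>2 \<le> \<gamma>" using V_lower[of w] by auto
      hence "(eucl_norm w)\<^sup>2 \<le> \<gamma> / \<alpha>" using \<alpha>_pos by (simp add: field_simps)
      thus "eucl_norm w \<le> sqrt (\<gamma> / \<alpha>)" by (rule real_le_rsqrt)
    qed
    moreover have "v \<in> ?K" using v above[of 0] by auto
    moreover have "continuous_map (eucl_top n) euclideanreal (\<lambda>w. V w - V (f w))"
      using continuous_map_compose[OF f_cont V_cont]
      by (intro continuous_map_diff V_cont) (simp add: comp_def)
    ultimately obtain a where a: "a \<in> ?K"
      "\<And>w. w \<in> ?K \<Longrightarrow> V a - V (f a) \<le> V w - V (f w)"
      using compactin_attains_inf[of "eucl_top n" ?K "\<lambda>w. V w - V (f w)"] by blast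
    define d where "d = V a - V (f a)"
    have "a \<noteq> 0\<^sub>v n" using a(1) e V_zero by auto
    hence d: "d > 0" using a(1) dec by (auto simp: d_def decreasing_below_def)
    have bound: "V (?x t) \<le> V v - real t * d" for t
    proof (induction t)
      case (Suc t)
      have "d \<le> V (?x t) - V (f (?x t))" using a(2)[of "?x t"] x above by (simp add: d_def)
      thus ?case using Suc by (simp add: algebra_simps)
    qed simp
    obtain t :: nat where "V v < real t * d" using reals_Archimedean3[OF d] by blast
    thus False using above[of t] e bound[of t] by linarith
  qed
  have "(\<lambda>t. eucl_norm (?x t)) \<longlonglongrightarrow> 0"
  proof (rule LIMSEQ_I)
    fix r :: real assume r: "0 < r"
    \<comment> \<open>Below the level \<open>\<alpha> * r\<^sup>2\<close> the lower bound on
      \<open>V\<close> forces the norm below \<open>r\<close>.\<close>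
    then obtain t0 where t0: "V (?x t0) < \<alpha> * r\<^sup>2" using reach[of "\<alpha> * r\<^sup>2"] \<alpha>_pos by auto
    have "norm (eucl_norm (?x t) - 0) < r" if "t0 \<le> t" for t
    proof -
      have "\<alpha> * (eucl_norm (?x t))\<^sup>2 \<le> V (?x t0)"
        using V_lower[OF x(1)[of t]] decseqD[OF \<open>decseq _\<close> that] by linarith
      hence "\<alpha> * (eucl_norm (?x t))\<^sup>2 < \<alpha> * r\<^sup>2" using t0 by linarith
      hence "(eucl_norm (?x t))\<^sup>2 < r\<^sup>2" using \<alpha>_pos by simp
      thus ?thesis using r by (simp add: power_less_imp_less_base)
    qed
    thus "\<exists>no. \<forall>t\<ge>no. norm (eucl_norm (?x t) - 0) < r" by blast
  qed
  thus ?thesis using solution_tendsto_zero_iff x(1) by blast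
qed

text \<open>Continuity of \<open>V\<close> puts a ball around the origin inside each sublevel set of
  positive level. The level \<gamma> gives attraction; for stability the level is taken so small
  that its invariant sublevel set lies in the \<epsilon>-ball.\<close>

lemma asymptotically_stable_zero:
  assumes g: "\<gamma> > 0" and dec: "decreasing_below \<gamma>"
  shows "asymptotically_stable n f (0\<^sub>v n)"
  unfolding asymptotically_stable_def
proof (intro conjI)
  show "equilibrium n f (0\<^sub>v n)" by (simp add: equilibrium_def f_zero)
  have small: "\<exists>\<delta>>0. \<forall>v\<in>carrier_vec n. eucl_dist n v (0\<^sub>v n) < \<delta> \<longrightarrow> V v \<le> c" if c: "c > 0" for c
  proof -
    obtain \<delta> where "\<delta> > 0"
      "\<And>v. v \<in> carrier_vec n \<Longrightarrow> eucl_norm v < \<delta> \<Longrightarrow> \<bar>V v - V (0\<^sub>v n)\<bar> < c"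
      using eucl_continuous_at_zero[OF V_cont c] by blast
    thus ?thesis using V_zero by (intro exI[of _ \<delta>]) (fastforce simp: eucl_dist_zero)
  qed
  show "locally_attractive n f (0\<^sub>v n)"
    using small[OF g] sublevel_attracted[OF dec] unfolding locally_attractive_def by blast
  show "lyapunov_stable n f (0\<^sub>v n)"
    unfolding lyapunov_stable_def
  proof (intro allI impI)
    fix \<epsilon> :: real assume e: "\<epsilon> > 0"
    \<comment> \<open>The bound by \<gamma> preserves the decrease; halving makes the comparison
      with \<open>\<alpha> * \<epsilon>\<^sup>2\<close> strict.\<close>
    define c where "c = min \<gamma> (\<alpha> * \<epsilon>\<^sup>2 / 2)"
    have c: "c > 0" "c \<le> \<gamma>" "c < \<alpha> * \<epsilon>\<^sup>2" using g e \<alpha>_pos by (auto simp: c_def min_less_iff_disj)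
    have dec_c: "decreasing_below c" using dec c by (auto simp: decreasing_below_def)
    have "eucl_dist n ((f ^^ t) v) (0\<^sub>v n) < \<epsilon>" if v: "v \<in> carrier_vec n" "V v \<le> c" for v t
    proof -
      have x: "(f ^^ t) v \<in> carrier_vec n" "V ((f ^^ t) v) \<le> c"
        using sublevel_invariant[OF dec_c v] by auto
      hence "\<alpha> * (eucl_norm ((f ^^ t) v))\<^sup>2 < \<alpha> * \<epsilon>\<^sup>2" using V_lower[OF x(1)] c by linarith
      hence "eucl_norm ((f ^^ t) v) < \<epsilon>" using \<alpha>_pos e by (simp add: power_less_imp_less_base)
      thus ?thesis using x by (simp add: eucl_dist_zero)
    qed
    thus "\<exists>\<delta>>0. \<forall>x0\<in>carrier_vec n. eucl_dist n x0 (0\<^sub>v n) < \<delta> \<longrightarrow>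
        (\<forall>t. eucl_dist n ((f ^^ t) x0) (0\<^sub>v n) < \<epsilon>)"
      using small[OF c(1)] by blast
  qed
qed

end

subsection \<open>Positive definite matrices\<close>

lemma mult_mat_zero_vec: "P \<in> carrier_mat k n \<Longrightarrow> P *\<^sub>v 0\<^sub>v n = (0\<^sub>v k :: real vec)"
  by (intro eq_vecI) auto

lemma zero_mat_mult_vec: "v \<in> carrier_vec n \<Longrightarrow> 0\<^sub>m k n *\<^sub>v v = (0\<^sub>v k :: real vec)"
  by (intro eq_vecI) auto

lemma symmetric_mat_scalar_prod:
  assumes "symmetric_mat n P" "v \<in> carrier_vec n" "w \<in> carrier_vec n"
  shows "(P *\<^sub>v v) \<bullet> w = v \<bullet> (P *\<^sub>v w)"
  using assms transpose_vec_mult_scalar[of P n n w v] by (simp add: symmetric_mat_def)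

lemma quadratic_form_add:
  assumes W: "symmetric_mat n W" and v: "v \<in> carrier_vec n" and w: "w \<in> carrier_vec n"
  shows "(v + w) \<bullet> (W *\<^sub>v (v + w)) = v \<bullet> (W *\<^sub>v v) + 2 * (v \<bullet> (W *\<^sub>v w)) + w \<bullet> (W *\<^sub>v w)"
proof -
  have c: "W \<in> carrier_mat n n" using W by (simp add: symmetric_mat_def)
  hence cv: "W *\<^sub>v v \<in> carrier_vec n" "W *\<^sub>v w \<in> carrier_vec n" using v w by auto
  have "w \<bullet> (W *\<^sub>v v) = v \<bullet> (W *\<^sub>v w)"
    using symmetric_mat_scalar_prod[OF W v w] comm_scalar_prod[OF w cv(1)] by simp
  moreover have "(v + w) \<bullet> (W *\<^sub>v (v + w)) =
      v \<bullet> (W *\<^sub>v v) + v \<bullet> (W *\<^sub>v w) + (w \<bullet> (W *\<^sub>v v) + w \<bullet> (W *\<^sub>v w))"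
    using v w cv by (simp add: mult_add_distrib_mat_vec[OF c v w] add_scalar_prod_distrib[of _ n]
      scalar_prod_add_distrib[of _ n])
  ultimately show ?thesis by simp
qed

lemma quadratic_form_smult:
  fixes W :: "real mat"
  assumes "W \<in> carrier_mat n n" "v \<in> carrier_vec n"
  shows "(c \<cdot>\<^sub>v v) \<bullet> (W *\<^sub>v (c \<cdot>\<^sub>v v)) = c\<^sup>2 * (v \<bullet> (W *\<^sub>v v))"
  using assms by (simp add: mult_mat_vec[OF assms] power2_eq_square)

text \<open>A nonzero kernel vector would annihilate the quadratic form, so the determinant is
  nonzero and \<open>inv_mat\<close> is a genuine inverse. Writing v = P w with w the image of v
  under the inverse turns the form of the inverse at v into the form of \<open>P\<close> at
  w.\<close>

lemma pos_def_inv_mat: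
  assumes P: "pos_def_mat n P"
  shows "inv_mat P \<in> carrier_mat n n" "P * inv_mat P = 1\<^sub>m n" "inv_mat P * P = 1\<^sub>m n"
    and "pos_def_mat n (inv_mat P)"
proof -
  have c: "P \<in> carrier_mat n n" and sym: "symmetric_mat n P"
    using P by (auto simp: pos_def_mat_def symmetric_mat_def)
  have "det P \<noteq> 0"
  proof
    assume "det P = 0"
    then obtain v where "v \<in> carrier_vec n" "v \<noteq> 0\<^sub>v n" "P *\<^sub>v v = 0\<^sub>v n"
      using det_0_iff_vec_prod_zero_field[OF c] by auto
    thus False using P unfolding pos_def_mat_def by (metis scalar_prod_right_zero less_irrefl)
  qed
  hence "P \<in> Units (ring_mat TYPE(real) n ())" by (rule det_non_zero_imp_unit[OF c])
  then obtain W where "mat_inverse P = Some W"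
    using mat_inverse(1)[OF c, of "()"] by (cases "mat_inverse P") auto
  with mat_inverse(2)[OF c] show inv: "inv_mat P \<in> carrier_mat n n" "P * inv_mat P = 1\<^sub>m n"
      "inv_mat P * P = 1\<^sub>m n"
    by (auto simp: inv_mat_def)
  let ?W = "inv_mat P"
  \<comment> \<open>Inserting \<open>P * ?W = 1\<close> and replacing \<open>P\<close> by its
    transpose exhibits the transpose of \<open>P * ?W\<close>, again the identity.\<close>
  have "transpose_mat ?W = transpose_mat ?W * (P * ?W)" using inv by simp
  also have "\<dots> = (transpose_mat ?W * transpose_mat P) * ?W"
    using inv c sym by (simp add: symmetric_mat_def)
  also have "\<dots> = transpose_mat (P * ?W) * ?W" by (subst transpose_mult[OF c inv(1)]) simp
  also have "\<dots> = ?W" using inv by simp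
  finally have symW: "symmetric_mat n ?W" using inv by (simp add: symmetric_mat_def)
  have "v \<bullet> (?W *\<^sub>v v) > 0" if v: "v \<in> carrier_vec n" "v \<noteq> 0\<^sub>v n" for v
  proof -
    have Wv: "?W *\<^sub>v v \<in> carrier_vec n" using inv v by auto
    have PW: "P *\<^sub>v (?W *\<^sub>v v) = v"
      using assoc_mult_mat_vec[OF c inv(1) v(1)] inv(2) v(1) by simp
    hence "?W *\<^sub>v v \<noteq> 0\<^sub>v n" using v(2) c by (metis mult_mat_zero_vec)
    hence "(?W *\<^sub>v v) \<bullet> (P *\<^sub>v (?W *\<^sub>v v)) > 0" using P Wv by (auto simp: pos_def_mat_def)
    thus ?thesis using PW comm_scalar_prod[OF Wv v(1)] by simp
  qed
  thus "pos_def_mat n ?W" using symW by (simp add: pos_def_mat_def)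
qed

text \<open>The block form is evaluated at the stacked vector (a, b), nonzero because
  \<open>a\<close> is; the two off-diagonal terms agree by transposition.\<close>

lemma pos_def_block_form:
  assumes pd: "pos_def_mat (n + n) (four_block_mat P (transpose_mat F) F P)"
    and P: "P \<in> carrier_mat n n" and F: "F \<in> carrier_mat n n"
    and a: "a \<in> carrier_vec n" "a \<noteq> 0\<^sub>v n" and b: "b \<in> carrier_vec n"
  shows "a \<bullet> (P *\<^sub>v a) + 2 * (b \<bullet> (F *\<^sub>v a)) + b \<bullet> (P *\<^sub>v b) > 0"
proof -
  have "a @\<^sub>v b \<noteq> 0\<^sub>v n @\<^sub>v 0\<^sub>v n" using a by (simp add: append_vec_eq[of a n])
  moreover have "0\<^sub>v n @\<^sub>v 0\<^sub>v n = (0\<^sub>v (n + n) :: real vec)" by (rule eq_vecI) auto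
  ultimately have "0 < (a @\<^sub>v b) \<bullet> (four_block_mat P (transpose_mat F) F P *\<^sub>v (a @\<^sub>v b))"
    using pd a b by (simp add: pos_def_mat_def)
  also have "\<dots> = (a @\<^sub>v b) \<bullet> ((P *\<^sub>v a + transpose_mat F *\<^sub>v b) @\<^sub>v (F *\<^sub>v a + P *\<^sub>v b))"
    using P F a b by (subst four_block_mat_mult_vec[of _ n n _ n]) auto
  also have "\<dots> = a \<bullet> (P *\<^sub>v a + transpose_mat F *\<^sub>v b) + b \<bullet> (F *\<^sub>v a + P *\<^sub>v b)"
    using P F a b by (intro scalar_prod_append[of _ n _ n]) auto
  also have "\<dots> = a \<bullet> (P *\<^sub>v a) + a \<bullet> (transpose_mat F *\<^sub>v b) + (b \<bullet> (F *\<^sub>v a) + b \<bullet> (P *\<^sub>v b))"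
    using P F a b by (simp add: scalar_prod_add_distrib[of _ n])
  also have "a \<bullet> (transpose_mat F *\<^sub>v b) = b \<bullet> (F *\<^sub>v a)"
    using transpose_vec_mult_scalar[OF F a(1) b] F a b
    by (subst comm_scalar_prod[of _ n]) auto
  finally show ?thesis by simp
qed

text \<open>Taking (v, 0) in the block form leaves only the upper left block.\<close>

lemma pos_def_block_diag:
  assumes pd: "pos_def_mat (n + n) (four_block_mat P (transpose_mat F) F P)"
    and P: "symmetric_mat n P" and F: "F \<in> carrier_mat n n"
  shows "pos_def_mat n P"
proof -
  have c: "P \<in> carrier_mat n n" using P by (simp add: symmetric_mat_def)
  show ?thesis unfolding pos_def_mat_def
  proof (intro conjI ballI impI P)
    fix v :: "real vec" assume v: "v \<in> carrier_vec n" "v \<noteq> 0\<^sub>v n"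
    have "P *\<^sub>v 0\<^sub>v n = 0\<^sub>v n" by (rule mult_mat_zero_vec[OF c])
    with pos_def_block_form[OF pd c F v, of "0\<^sub>v n"] show "v \<bullet> (P *\<^sub>v v) > 0"
      using v F c by simp
  qed
qed

text \<open>The Schur complement, evaluated at the block vector \<open>(P\<inverse> v, - P\<inverse> F P\<inverse> v)\<close>.\<close>

lemma pos_def_block_decrease:
  assumes pd: "pos_def_mat (n + n) (four_block_mat P (transpose_mat F) F P)"
    and P: "symmetric_mat n P" and F: "F \<in> carrier_mat n n"
    and M: "M = F * inv_mat P" and v: "v \<in> carrier_vec n" "v \<noteq> 0\<^sub>v n"
  shows "(M *\<^sub>v v) \<bullet> (inv_mat P *\<^sub>v (M *\<^sub>v v)) < v \<bullet> (inv_mat P *\<^sub>v v)"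
proof -
  have c: "P \<in> carrier_mat n n" using P by (simp add: symmetric_mat_def)
  let ?W = "inv_mat P"
  note W = pos_def_inv_mat[OF pos_def_block_diag[OF pd P F]]
  have PW: "P *\<^sub>v (?W *\<^sub>v w) = w" if "w \<in> carrier_vec n" for w
    using assoc_mult_mat_vec[OF c W(1) that] W(2) that by simp
  define a where "a = ?W *\<^sub>v v"
  define y where "y = M *\<^sub>v v"
  define b where "b = ?W *\<^sub>v y"
  have ca: "a \<in> carrier_vec n" and cy: "y \<in> carrier_vec n" and cb: "b \<in> carrier_vec n"
    using W(1) F v M by (auto simp: a_def y_def b_def)
  have Pa: "P *\<^sub>v a = v" and Pb: "P *\<^sub>v b = y" using PW v cy by (auto simp: a_def b_def)
  have Fa: "F *\<^sub>v a = y" using assoc_mult_mat_vec[OF F W(1) v(1)] by (simp add: a_def y_def M)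
  have "a \<noteq> 0\<^sub>v n" using Pa v c by (metis mult_mat_zero_vec)
  \<comment> \<open>With \<open>F a = y\<close> and \<open>P b = y\<close>, the sign turns the cross
    term into -2 (b . y), which the last term b . y reduces to -(b . y).\<close>
  from pos_def_block_form[OF pd c F ca this, of "- 1 \<cdot>\<^sub>v b"]
  have "0 < a \<bullet> v - b \<bullet> y"
    using ca cb cy c by (simp add: Pa Pb Fa mult_mat_vec[OF c cb])
  thus ?thesis
    using comm_scalar_prod[OF ca v(1)] comm_scalar_prod[OF cb cy] by (simp add: a_def b_def y_def)
qed

subsection \<open>The closed loop in terms of the data\<close>

lemma sample_mat_carrier [simp]: "sample_mat d T v \<in> carrier_mat d T"
  using mat_of_cols_carrier[of d "map v [0..<T]"] by (simp add: sample_mat_def)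

lemma col_sample_mat:
  "j < T \<Longrightarrow> v j \<in> carrier_vec d \<Longrightarrow> col (sample_mat d T v) j = v j"
  by (simp add: sample_mat_def)

text \<open>Compared column by column, this is the system equation at each sample. It collects the
  \<open>T\<close> measured transitions into one matrix identity.\<close>

lemma sample_mat_data_equation:
  assumes A: "A \<in> carrier_mat n S" and B: "B \<in> carrier_mat n m"
    and z: "\<And>k. k < T \<Longrightarrow> z k \<in> carrier_vec S" and u: "\<And>k. k < T \<Longrightarrow> u k \<in> carrier_vec m"
    and y: "\<And>k. k < T \<Longrightarrow> y k = A *\<^sub>v z k + B *\<^sub>v u k"
  shows "sample_mat n T y = A * sample_mat S T z + B * sample_mat m T u"
proof (rule mat_col_eqI)
  let ?Z = "sample_mat S T z" and ?U = "sample_mat m T u"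
  have AZ: "A * ?Z \<in> carrier_mat n T" and BU: "B * ?U \<in> carrier_mat n T"
    using mult_carrier_mat[OF A sample_mat_carrier] mult_carrier_mat[OF B sample_mat_carrier] .
  show "dim_row (sample_mat n T y) = dim_row (A * ?Z + B * ?U)"
    and "dim_col (sample_mat n T y) = dim_col (A * ?Z + B * ?U)"
    using BU by (auto simp: sample_mat_def)
  fix j assume "j < dim_col (A * ?Z + B * ?U)"
  hence j: "j < T" by (simp add: sample_mat_def)
  have "y j \<in> carrier_vec n"
    unfolding y[OF j] using mult_mat_vec_carrier[OF A z[OF j]] mult_mat_vec_carrier[OF B u[OF j]] by simp
  hence "col (sample_mat n T y) j = A *\<^sub>v z j + B *\<^sub>v u j"
    using j y by (simp add: col_sample_mat)
  also have "\<dots> = col (A * ?Z) j + col (B * ?U) j"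
    using j z u
    by (simp add: col_mult2[OF A sample_mat_carrier] col_mult2[OF B sample_mat_carrier] col_sample_mat)
  also have "\<dots> = col (A * ?Z + B * ?U) j"
    using AZ BU j by (intro col_add[symmetric]) auto
  finally show "col (sample_mat n T y) j = col (A * ?Z + B * ?U) j" .
qed

text \<open>The lower blocks in \<open>append_cols\<close> have no rows, so block multiplication
  adds only an empty lower part.\<close>

lemma append_cols_mult_vec:
  assumes C: "C \<in> carrier_mat r k" and D: "D \<in> carrier_mat r l"
    and v: "v \<in> carrier_vec k" and w: "w \<in> carrier_vec l"
  shows "append_cols C D *\<^sub>v (v @\<^sub>v w) = C *\<^sub>v v + D *\<^sub>v w"
proof -
  have "append_cols C D *\<^sub>v (v @\<^sub>v w)
      = (C *\<^sub>v v + D *\<^sub>v w) @\<^sub>v (0\<^sub>m 0 k *\<^sub>v v + 0\<^sub>m 0 l *\<^sub>v w)"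
    using C D v w unfolding append_cols_def
    by (subst four_block_mat_mult_vec[of C r k D l _ 0]) auto
  also have "\<dots> = C *\<^sub>v v + D *\<^sub>v w"
    using C D by (intro eq_vecI) auto
  finally show ?thesis .
qed

text \<open>The vector \<open>y = C v + G w\<close> holds common coefficients: \<open>Z0\<close>
  maps it to the lifted state and \<open>U0\<close> to the control input. The closed loop is
  therefore \<open>(A * Z0 + B * U0)\<close> applied to \<open>y\<close>, that is, \<open>X1\<close>
  applied to \<open>y\<close>.\<close>

lemma closed_loop_data_representation:
  assumes A: "A \<in> carrier_mat n S" and B: "B \<in> carrier_mat n m"
    and Z0: "Z0 \<in> carrier_mat S T" and U0: "U0 \<in> carrier_mat m T"
    and C: "C \<in> carrier_mat T n" and G: "G \<in> carrier_mat T k" and S: "S = n + k"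
    and X1: "X1 = A * Z0 + B * U0"
    and v: "v \<in> carrier_vec n" and w: "w \<in> carrier_vec k"
    and ZC: "Z0 *\<^sub>v (C *\<^sub>v v) = v @\<^sub>v 0\<^sub>v k" and ZG: "Z0 *\<^sub>v (G *\<^sub>v w) = 0\<^sub>v n @\<^sub>v w"
  shows "A *\<^sub>v (v @\<^sub>v w) + B *\<^sub>v ((U0 * append_cols C G) *\<^sub>v (v @\<^sub>v w))
    = (X1 * C) *\<^sub>v v + (X1 * G) *\<^sub>v w"
proof -
  define y where "y = C *\<^sub>v v + G *\<^sub>v w"
  have cy: "y \<in> carrier_vec T" and Cv: "C *\<^sub>v v \<in> carrier_vec T" and Gw: "G *\<^sub>v w \<in> carrier_vec T"
    using C G v w by (auto simp: y_def)
  have X1c: "X1 \<in> carrier_mat n T" using A B Z0 U0 X1 by auto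
  have vw: "v @\<^sub>v w \<in> carrier_vec (n + k)" using v w by simp
  have app: "append_cols C G \<in> carrier_mat T (n + k)"
    using C G by (auto simp: append_cols_def)
  have Zy: "Z0 *\<^sub>v y = v @\<^sub>v w"
    using mult_add_distrib_mat_vec[OF Z0 Cv Gw] v w
    by (simp add: y_def ZC ZG append_vec_add[of _ n _ _ k])
  have "(U0 * append_cols C G) *\<^sub>v (v @\<^sub>v w) = U0 *\<^sub>v y"
    using assoc_mult_mat_vec[OF U0 app vw] append_cols_mult_vec[OF C G v w] by (simp add: y_def)
  hence "A *\<^sub>v (v @\<^sub>v w) + B *\<^sub>v ((U0 * append_cols C G) *\<^sub>v (v @\<^sub>v w))
      = A *\<^sub>v (Z0 *\<^sub>v y) + B *\<^sub>v (U0 *\<^sub>v y)"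
    by (simp add: Zy)
  also have "\<dots> = X1 *\<^sub>v y"
    using A B Z0 U0 cy
    by (simp add: X1 add_mult_distrib_mat_vec[of _ n T]
      assoc_mult_mat_vec[OF A Z0 cy] assoc_mult_mat_vec[OF B U0 cy])
  also have "\<dots> = (X1 * C) *\<^sub>v v + (X1 * G) *\<^sub>v w"
    using mult_add_distrib_mat_vec[OF X1c Cv Gw] assoc_mult_mat_vec[OF X1c C v]
      assoc_mult_mat_vec[OF X1c G w]
    by (simp add: y_def)
  finally show ?thesis .
qed

subsection \<open>Decrease near the origin\<close>

text \<open>The limit concerns a punctured neighbourhood only; continuity of \<open>Q\<close> and
  nearby nonzero points force \<open>Q\<close> to vanish at the origin. Such points exist because
  \<open>n\<close> is positive; in dimension 0 the origin is isolated.\<close>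

lemma little_o_at_zero:
  assumes n: "0 < n" and cont: "continuous_map (eucl_top n) (eucl_top k) Q"
    and lim: "((\<lambda>v. eucl_norm (Q v) / eucl_norm v) \<longlongrightarrow> 0) (atin (eucl_top n) (0\<^sub>v n))"
    and e: "0 < e"
  shows "\<exists>\<delta>>0. \<forall>v\<in>carrier_vec n. eucl_norm v < \<delta> \<longrightarrow> eucl_norm (Q v) \<le> e * eucl_norm v"
proof -
  have punctured: "\<exists>\<delta>>0. \<forall>v\<in>carrier_vec n. 0 < eucl_norm v \<and> eucl_norm v < \<delta> \<longrightarrow>
      eucl_norm (Q v) \<le> c * eucl_norm v"
    if c: "0 < c" for c
  proof -
    obtain \<delta> where d: "\<delta> > 0" "\<And>v. v \<in> carrier_vec n \<and> 0 < eucl_dist n v (0\<^sub>v n) \<and> eucl_dist n v (0\<^sub>v n) < \<delta>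
        \<Longrightarrow> \<bar>eucl_norm (Q v) / eucl_norm v\<bar> < c"
      using tendstoD[OF lim c] by (auto simp: eucl_top_def eucl.eventually_atin_metric)
    have "eucl_norm (Q v) \<le> c * eucl_norm v"
      if "v \<in> carrier_vec n" "0 < eucl_norm v" "eucl_norm v < \<delta>" for v
      using d(2)[of v] that by (simp add: eucl_dist_zero field_simps)
    thus ?thesis using d(1) by blast
  qed
  have Q0: "eucl_norm (Q (0\<^sub>v n)) = 0"
  proof (rule ccontr)
    let ?q = "eucl_norm (Q (0\<^sub>v n)) / 2"
    assume "\<not> ?thesis"
    hence q: "?q > 0" using eucl_norm_nonneg[of "Q (0\<^sub>v n)"] by linarith
    obtain \<delta> where d: "\<delta> > 0" "\<And>v. v \<in> carrier_vec n \<Longrightarrow> eucl_norm v < \<delta> \<Longrightarrow>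
        \<bar>eucl_norm (Q v) - eucl_norm (Q (0\<^sub>v n))\<bar> < ?q"
      using eucl_continuous_at_zero[OF continuous_map_eucl_norm[OF cont] q] by blast
    obtain \<delta>' where d': "\<delta>' > 0" "\<And>v. v \<in> carrier_vec n \<Longrightarrow> 0 < eucl_norm v \<Longrightarrow> eucl_norm v < \<delta>' \<Longrightarrow>
        eucl_norm (Q v) \<le> 1 * eucl_norm v"
      using punctured[of 1] by auto
    \<comment> \<open>At the vector of length \<open>t\<close> along the first axis, continuity
      gives |Q| > \<open>?q\<close>, while the punctured bound gives |Q| \<le> t <
      \<open>?q\<close>.\<close>
    define t where "t = min \<delta> (min \<delta>' ?q) / 2"
    have t: "0 < t" "t < \<delta>" "t < \<delta>'" "t < ?q" using d d' q by (auto simp: t_def min_def)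
    have "eucl_norm (unit_vec n 0) = 1" using n by (simp add: eucl_norm_eq_sqrt)
    hence nv: "eucl_norm (t \<cdot>\<^sub>v unit_vec n 0) = t" using t by (simp add: eucl_norm_smult)
    show False
      using d(2)[of "t \<cdot>\<^sub>v unit_vec n 0"] d'(2)[of "t \<cdot>\<^sub>v unit_vec n 0"] t unfolding nv by simp
  qed
  obtain \<delta> where d: "\<delta> > 0" "\<And>v. v \<in> carrier_vec n \<Longrightarrow> 0 < eucl_norm v \<Longrightarrow> eucl_norm v < \<delta> \<Longrightarrow>
      eucl_norm (Q v) \<le> e * eucl_norm v"
    using punctured[OF e] by auto
  have "eucl_norm (Q v) \<le> e * eucl_norm v" if v: "v \<in> carrier_vec n" "eucl_norm v < \<delta>" for v
  proof (cases "v = 0\<^sub>v n")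
    case True
    thus ?thesis using Q0 e by simp
  next
    case False
    hence "0 < eucl_norm v" using eucl_norm_eq_0_iff[OF v(1)] eucl_norm_nonneg[of v] by linarith
    thus ?thesis using d(2) v by simp
  qed
  thus ?thesis using d(1) by blast
qed

text \<open>The linear decrease is a positive quadratic form, hence at least \<beta> |v|^2. If |Q v|
  \<le> e |v| with e \<le> 1, the terms containing \<open>Q\<close> contribute at most D e |v|^2,
  and \<open>e\<close> is chosen with D e < \<beta>.\<close>

lemma perturbed_linear_decrease:
  assumes W: "symmetric_mat n W" and M: "M \<in> carrier_mat n n" and N: "N \<in> carrier_mat n k"
    and Q: "\<And>v. v \<in> carrier_vec n \<Longrightarrow> Q v \<in> carrier_vec k"
    and lin: "\<And>v. v \<in> carrier_vec n \<Longrightarrow> v \<noteq> 0\<^sub>v n \<Longrightarrow>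
      (M *\<^sub>v v) \<bullet> (W *\<^sub>v (M *\<^sub>v v)) < v \<bullet> (W *\<^sub>v v)"
    and small: "\<And>e. 0 < e \<Longrightarrow>
      \<exists>\<delta>>0. \<forall>v\<in>carrier_vec n. eucl_norm v < \<delta> \<longrightarrow> eucl_norm (Q v) \<le> e * eucl_norm v"
  obtains \<delta> where "\<delta> > 0" "\<And>v. v \<in> carrier_vec n \<Longrightarrow> v \<noteq> 0\<^sub>v n \<Longrightarrow> eucl_norm v < \<delta> \<Longrightarrow>
      (M *\<^sub>v v + N *\<^sub>v Q v) \<bullet> (W *\<^sub>v (M *\<^sub>v v + N *\<^sub>v Q v)) < v \<bullet> (W *\<^sub>v v)"
proof -
  have Wc: "W \<in> carrier_mat n n" using W by (simp add: symmetric_mat_def)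
  let ?q = "\<lambda>v. v \<bullet> (W *\<^sub>v v) - (M *\<^sub>v v) \<bullet> (W *\<^sub>v (M *\<^sub>v v))"
  have "continuous_map (eucl_top n) euclideanreal ?q"
    by (intro continuous_map_diff continuous_map_scalar_prod[of _ n] continuous_map_mult_mat_vec[OF Wc]
      continuous_map_mult_mat_vec[OF M] continuous_map_eucl_ident)
  moreover have "?q (c \<cdot>\<^sub>v v) = c\<^sup>2 * ?q v" if v: "v \<in> carrier_vec n" for c v
    using quadratic_form_smult[OF Wc, of "M *\<^sub>v v" c] quadratic_form_smult[OF Wc v, of c] M v
    by (simp add: mult_mat_vec[OF M v] right_diff_distrib)
  moreover have "?q v > 0" if "v \<in> carrier_vec n" "v \<noteq> 0\<^sub>v n" for v
    using lin[OF that] by simp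
  ultimately obtain \<beta> where b: "\<beta> > 0" "\<And>v. v \<in> carrier_vec n \<Longrightarrow> \<beta> * (eucl_norm v)\<^sup>2 \<le> ?q v"
    using pos_homogeneous_quadratic_bound[of n ?q] by blast
  obtain CM where CM: "CM \<ge> 0" "\<And>v. v \<in> carrier_vec n \<Longrightarrow> eucl_norm (M *\<^sub>v v) \<le> CM * eucl_norm v"
    using mult_mat_vec_norm_bound[OF M] by blast
  obtain CN where CN: "CN \<ge> 0" "\<And>v. v \<in> carrier_vec k \<Longrightarrow> eucl_norm (N *\<^sub>v v) \<le> CN * eucl_norm v"
    using mult_mat_vec_norm_bound[OF N] by blast
  obtain CW where CW: "CW \<ge> 0" "\<And>v. v \<in> carrier_vec n \<Longrightarrow> eucl_norm (W *\<^sub>v v) \<le> CW * eucl_norm v"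
    using mult_mat_vec_norm_bound[OF Wc] by blast
  have form: "v \<bullet> (W *\<^sub>v w) \<le> CW * (eucl_norm v * eucl_norm w)"
    if "v \<in> carrier_vec n" "w \<in> carrier_vec n" for v w
  proof -
    have "v \<bullet> (W *\<^sub>v w) \<le> eucl_norm v * eucl_norm (W *\<^sub>v w)"
      using eucl_norm_cauchy_schwarz[of v n "W *\<^sub>v w"] that Wc by auto
    also have "\<dots> \<le> eucl_norm v * (CW * eucl_norm w)"
      using CW(2)[OF that(2)] by (intro mult_left_mono) auto
    finally show ?thesis by (simp add: mult_ac)
  qed
  \<comment> \<open>The first summand comes from the doubled cross term, the second from the term
    quadratic in \<open>N *\<^sub>v Q v\<close>.\<close>
  define D where "D = CW * (2 * CM * CN + CN * CN)"
  have D: "D \<ge> 0" using CM CN CW by (simp add: D_def)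
  \<comment> \<open>The bound 1 allows e^2 to be replaced by e; \<open>D + 1\<close> keeps the
    denominator positive when \<open>D\<close> is 0.\<close>
  define e where "e = min 1 (\<beta> / (2 * (D + 1)))"
  have e: "0 < e" "e \<le> 1" using b D by (auto simp: e_def)
  have "D * e \<le> D * (\<beta> / (2 * (D + 1)))" using D by (intro mult_left_mono) (auto simp: e_def)
  also have "\<dots> < \<beta>" using b D by (simp add: field_simps add_nonneg_pos)
  finally have De: "D * e < \<beta>" .
  obtain \<delta> where d: "\<delta> > 0" "\<And>v. v \<in> carrier_vec n \<Longrightarrow> eucl_norm v < \<delta> \<Longrightarrow> eucl_norm (Q v) \<le> e * eucl_norm v"
    using small[OF e(1)] by blast
  show ?thesis
  proof (rule that[OF d(1)])
    fix v assume v: "v \<in> carrier_vec n" "v \<noteq> 0\<^sub>v n" "eucl_norm v < \<delta>"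
    let ?a = "M *\<^sub>v v" and ?b = "N *\<^sub>v Q v" and ?r = "eucl_norm v"
    have r: "?r > 0" using eucl_norm_eq_0_iff[OF v(1)] eucl_norm_nonneg[of v] v(2) by linarith
    have ca: "?a \<in> carrier_vec n" and cb: "?b \<in> carrier_vec n" using M N v Q by auto
    have na: "eucl_norm ?a \<le> CM * ?r" using CM v by simp
    have "eucl_norm ?b \<le> CN * eucl_norm (Q v)" using CN Q v by simp
    also have "\<dots> \<le> CN * (e * ?r)" using d(2) v CN by (intro mult_left_mono) auto
    finally have nb: "eucl_norm ?b \<le> CN * e * ?r" by simp
    \<comment> \<open>In the quadratic term one factor keeps \<open>e\<close> and the other uses e
      \<le> 1, so the total stays linear in \<open>e\<close>.\<close>
    have "CN * e * ?r \<le> CN * 1 * ?r" using CN e r by (intro mult_right_mono mult_left_mono) auto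
    hence nb': "eucl_norm ?b \<le> CN * ?r" using nb by simp
    have "?a \<bullet> (W *\<^sub>v ?b) \<le> CW * ((CM * ?r) * (CN * e * ?r))"
      using CW CM r by (intro order_trans[OF form[OF ca cb]] mult_left_mono mult_mono na nb) auto
    moreover have "?b \<bullet> (W *\<^sub>v ?b) \<le> CW * ((CN * ?r) * (CN * e * ?r))"
      using CW CN r by (intro order_trans[OF form[OF cb cb]] mult_left_mono mult_mono nb nb') auto
    ultimately have "2 * (?a \<bullet> (W *\<^sub>v ?b)) + ?b \<bullet> (W *\<^sub>v ?b) \<le> D * e * ?r\<^sup>2"
      by (simp add: D_def algebra_simps power2_eq_square)
    also have "\<dots> < \<beta> * ?r\<^sup>2" using De r by simp
    also have "\<dots> \<le> ?q v" by (rule b(2)[OF v(1)])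
    finally show "(?a + ?b) \<bullet> (W *\<^sub>v (?a + ?b)) < v \<bullet> (W *\<^sub>v v)"
      by (simp add: quadratic_form_add[OF W ca cb])
  qed
qed

section \<open>The data-driven closed loop as an instance of the Lyapunov argument\<close>

theorem proposition1:
  fixes n m S T :: nat
    and A B :: "real mat"
    and Q Z :: "real vec \<Rightarrow> real vec"
    and x u :: "nat \<Rightarrow> real vec"
    and U0 X1 Z0 P1 Y1 G2 K M N :: "real mat"
    and h V :: "real vec \<Rightarrow> real"
    and W :: "real vec set"
    and R :: "real \<Rightarrow> real vec set"
    and f :: "real vec \<Rightarrow> real vec"
  assumes dims: "0 < n" "0 < m" "0 < T" "n \<le> S"
    and A: "A \<in> carrier_mat n S"
    and B: "B \<in> carrier_mat n m"
    and Q_cont: "continuous_map (eucl_top n) (eucl_top (S - n)) Q"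
    and Z_def: "\<And>v. Z v = v @\<^sub>v Q v"
    and x_dim: "\<And>k. k \<le> T \<Longrightarrow> x k \<in> carrier_vec n"
    and u_dim: "\<And>k. k < T \<Longrightarrow> u k \<in> carrier_vec m"
    and data: "\<And>k. k < T \<Longrightarrow> x (k + 1) = A *\<^sub>v Z (x k) + B *\<^sub>v u k"
    and U0_def: "U0 = sample_mat m T u"
    and X1_def: "X1 = sample_mat n T (\<lambda>k. x (k + 1))"
    and Z0_def: "Z0 = sample_mat S T (\<lambda>k. Z (x k))"
    and Q_lim: "((\<lambda>v. eucl_norm (Q v) / eucl_norm v) \<longlongrightarrow> 0) (atin (eucl_top n) (0\<^sub>v n))"
    and feasible: "sdp_feasible n S T X1 Z0 P1 Y1 G2"
    and K_def: "K = U0 * append_cols (Y1 * inv_mat P1) G2"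
    and M_def: "M = X1 * Y1 * inv_mat P1"
    and N_def: "N = X1 * G2"
    and h_def: "\<And>v. h v = (M *\<^sub>v v + N *\<^sub>v Q v) \<bullet> (inv_mat P1 *\<^sub>v (M *\<^sub>v v + N *\<^sub>v Q v))
                          - v \<bullet> (inv_mat P1 *\<^sub>v v)"
    and W_def: "W = {v \<in> carrier_vec n. h v < 0}"
    and V_def: "\<And>v. V v = v \<bullet> (inv_mat P1 *\<^sub>v v)"
    and R_def: "\<And>\<gamma>. R \<gamma> = {v \<in> carrier_vec n. V v \<le> \<gamma>}"
    and f_def: "\<And>v. f v = A *\<^sub>v Z v + B *\<^sub>v (K *\<^sub>v Z v)"
  shows "\<forall>\<gamma>. R \<gamma> \<subseteq> W \<union> {0\<^sub>v n} \<longrightarrow>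
           positively_invariant f (R \<gamma>) \<and> region_of_attraction n f (0\<^sub>v n) (R \<gamma>)"
proof -
  have F: "X1 * Y1 \<in> carrier_mat n n" and P: "symmetric_mat n P1"
    and Y1: "Y1 \<in> carrier_mat T n" and G2: "G2 \<in> carrier_mat T (S - n)"
    and ZY: "Z0 * Y1 = P1 @\<^sub>r 0\<^sub>m (S - n) n" and ZG: "Z0 * G2 = 0\<^sub>m n (S - n) @\<^sub>r 1\<^sub>m (S - n)"
    and pd: "pos_def_mat (n + n) (four_block_mat P1 (transpose_mat (X1 * Y1)) (X1 * Y1) P1)"
    using feasible by (auto simp: sdp_feasible_def X1_def intro!: mult_carrier_mat[OF sample_mat_carrier])
  have Pc: "P1 \<in> carrier_mat n n" using P by (simp add: symmetric_mat_def)
  note Wc = pos_def_inv_mat[OF pos_def_block_diag[OF pd P F]]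
  let ?W = "inv_mat P1" and ?g = "\<lambda>v. M *\<^sub>v v + N *\<^sub>v Q v"
  have Wsym: "symmetric_mat n ?W" using Wc(4) by (simp add: pos_def_mat_def)
  have X1c: "X1 \<in> carrier_mat n T" and Z0c: "Z0 \<in> carrier_mat S T" and U0c: "U0 \<in> carrier_mat m T"
    by (simp_all add: X1_def Z0_def U0_def)
  have Mc: "M \<in> carrier_mat n n" and Nc: "N \<in> carrier_mat n (S - n)"
    using F Wc(1) X1c G2 by (auto simp: M_def N_def)
  have Qc: "Q v \<in> carrier_vec (S - n)" if "v \<in> carrier_vec n" for v
    using continuous_map_eucl_carrier[OF Q_cont] that by simp
  have Zc: "Z (x k) \<in> carrier_vec S" if "k < T" for k
  proof -
    have "x k \<in> carrier_vec n" using x_dim that by simp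
    hence "x k @\<^sub>v Q (x k) \<in> carrier_vec (n + (S - n))" using Qc by simp
    thus ?thesis using dims(4) by (simp add: Z_def)
  qed
  have X1: "X1 = A * Z0 + B * U0"
    unfolding X1_def Z0_def U0_def by (rule sample_mat_data_equation[OF A B Zc u_dim data])
  have C: "Y1 * ?W \<in> carrier_mat T n" using Y1 Wc by simp
  \<comment> \<open>The first equality constraint, multiplied on the right by the inverse of
    \<open>P1\<close>, has an identity upper block and a zero lower block.\<close>
  have ZCv: "Z0 *\<^sub>v ((Y1 * ?W) *\<^sub>v v) = v @\<^sub>v 0\<^sub>v (S - n)" if v: "v \<in> carrier_vec n" for v
  proof -
    have Wv: "?W *\<^sub>v v \<in> carrier_vec n" using Wc(1) v by simp
    have "Z0 *\<^sub>v ((Y1 * ?W) *\<^sub>v v) = (Z0 * Y1) *\<^sub>v (?W *\<^sub>v v)"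
      using assoc_mult_mat_vec[OF Y1 Wc(1) v] assoc_mult_mat_vec[OF Z0c Y1 Wv] by simp
    also have "\<dots> = (P1 *\<^sub>v (?W *\<^sub>v v)) @\<^sub>v 0\<^sub>v (S - n)"
      using mat_mult_append[OF Pc zero_carrier_mat Wv] by (simp add: ZY zero_mat_mult_vec[OF Wv])
    also have "P1 *\<^sub>v (?W *\<^sub>v v) = v"
      using assoc_mult_mat_vec[OF Pc Wc(1) v] v by (simp add: Wc(2))
    finally show ?thesis .
  qed
  have ZGw: "Z0 *\<^sub>v (G2 *\<^sub>v w) = 0\<^sub>v n @\<^sub>v w" if w: "w \<in> carrier_vec (S - n)" for w
    using assoc_mult_mat_vec[OF Z0c G2 w] mat_mult_append[OF zero_carrier_mat one_carrier_mat w, of n] w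
    by (simp add: ZG zero_mat_mult_vec)
  \<comment> \<open>From here on the unknown \<open>A\<close> and \<open>B\<close> are gone: on the
    carrier the dynamics is expressed by \<open>M\<close> and \<open>N\<close>.\<close>
  have fg: "f v = ?g v" if v: "v \<in> carrier_vec n" for v
    unfolding f_def Z_def K_def
    using closed_loop_data_representation[OF A B Z0c U0c C G2 _ X1 v Qc[OF v]
      ZCv[OF v] ZGw[OF Qc[OF v]]] dims(4)
      assoc_mult_mat[OF X1c Y1 Wc(1)]
    by (simp add: M_def N_def)
  have f_cont: "continuous_map (eucl_top n) (eucl_top n) f"
  proof (rule continuous_map_eq)
    show "continuous_map (eucl_top n) (eucl_top n) ?g"
      by (intro continuous_map_add_vec continuous_map_mult_mat_vec[OF Mc]
        continuous_map_mult_mat_vec[OF Nc] continuous_map_eucl_ident Q_cont)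
  qed (simp add: fg)
  have V_cont: "continuous_map (eucl_top n) euclideanreal V"
    unfolding V_def[abs_def]
    by (intro continuous_map_scalar_prod[of _ n] continuous_map_mult_mat_vec[OF Wc(1)]
      continuous_map_eucl_ident)
  have V_hom: "V (c \<cdot>\<^sub>v v) = c\<^sup>2 * V v" if "v \<in> carrier_vec n" for c v
    unfolding V_def by (rule quadratic_form_smult[OF Wc(1) that])
  have V_pos: "V v > 0" if "v \<in> carrier_vec n" "v \<noteq> 0\<^sub>v n" for v
    using Wc(4) that by (simp add: V_def pos_def_mat_def)
  obtain \<alpha> where \<alpha>: "\<alpha> > 0" "\<And>v. v \<in> carrier_vec n \<Longrightarrow> \<alpha> * (eucl_norm v)\<^sup>2 \<le> V v"
    using pos_homogeneous_quadratic_bound[OF V_cont V_hom V_pos] by blast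
  note small = little_o_at_zero[OF dims(1) Q_cont Q_lim]
  have zero_norm: "eucl_norm (0\<^sub>v n) = 0" using eucl_norm_eq_0_iff[of "0\<^sub>v n" n] by simp
  \<comment> \<open>The little-o bound holds at the origin too, where its right-hand side is 0; this
    makes the origin an equilibrium.\<close>
  have "eucl_norm (Q (0\<^sub>v n)) \<le> 0"
  proof -
    obtain \<delta> where "\<delta> > 0" "\<forall>v\<in>carrier_vec n. eucl_norm v < \<delta> \<longrightarrow> eucl_norm (Q v) \<le> 1 * eucl_norm v"
      using small[of 1] by auto
    from this(2)[rule_format, of "0\<^sub>v n"] this(1) show ?thesis by (simp add: zero_norm)
  qed
  hence "Q (0\<^sub>v n) = 0\<^sub>v (S - n)"
    using eucl_norm_eq_0_iff[OF Qc[of "0\<^sub>v n"]] eucl_norm_nonneg[of "Q (0\<^sub>v n)"] by simp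
  hence f0: "f (0\<^sub>v n) = 0\<^sub>v n" using Mc Nc by (simp add: fg mult_mat_zero_vec)
  interpret lyapunov_function n f V \<alpha>
    using f_cont V_cont f0 \<alpha> Wc(1) by unfold_locales (auto simp: V_def)
  obtain \<delta> where d: "\<delta> > 0" "\<And>v. v \<in> carrier_vec n \<Longrightarrow> v \<noteq> 0\<^sub>v n \<Longrightarrow> eucl_norm v < \<delta> \<Longrightarrow>
      ?g v \<bullet> (?W *\<^sub>v ?g v) < v \<bullet> (?W *\<^sub>v v)"
    using perturbed_linear_decrease[OF Wsym Mc Nc Qc pos_def_block_decrease[OF pd P F M_def] small]
    by blast
  \<comment> \<open>This level confines the sublevel set to the \<delta>-ball, where the perturbed
    decrease holds. Stability thus comes from a positive level independent of \<gamma>, since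
    \<open>R \<gamma>\<close> may be just the origin or empty.\<close>
  have "decreasing_below (\<alpha> * \<delta>\<^sup>2 / 2)"
    unfolding decreasing_below_def
  proof (intro ballI impI)
    fix v assume v: "v \<in> carrier_vec n" "V v \<le> \<alpha> * \<delta>\<^sup>2 / 2" "v \<noteq> 0\<^sub>v n"
    have "\<alpha> * (eucl_norm v)\<^sup>2 < \<alpha> * \<delta>\<^sup>2"
      using \<alpha>(2)[OF v(1)] v(2) mult_pos_pos[OF \<alpha>(1), of "\<delta>\<^sup>2"] d(1) by simp
    hence "eucl_norm v < \<delta>" using \<alpha>(1) d(1) by (simp add: power_less_imp_less_base)
    thus "V (f v) < V v" using d(2) v by (simp add: V_def fg)
  qed
  hence stable: "asymptotically_stable n f (0\<^sub>v n)"
    using \<alpha>(1) d(1) by (intro asymptotically_stable_zero[of "\<alpha> * \<delta>\<^sup>2 / 2"]) auto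
  show ?thesis
  proof (intro allI impI)
    fix \<gamma> assume sub: "R \<gamma> \<subseteq> W \<union> {0\<^sub>v n}"
    \<comment> \<open>By \<open>fg\<close>, \<open>h v\<close> is the one-step change
      \<open>V (f v) - V v\<close>, so the assumed inclusion is exactly this decrease.\<close>
    have dec: "decreasing_below \<gamma>"
      unfolding decreasing_below_def
    proof (intro ballI impI)
      fix v assume v: "v \<in> carrier_vec n" "V v \<le> \<gamma>" "v \<noteq> 0\<^sub>v n"
      hence "h v < 0" using sub by (auto simp: R_def W_def)
      thus "V (f v) < V v" using v by (simp add: h_def V_def fg)
    qed
    show "positively_invariant f (R \<gamma>) \<and> region_of_attraction n f (0\<^sub>v n) (R \<gamma>)"
      using sublevel_invariant[OF dec] sublevel_attracted[OF dec] stable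
      by (auto simp: positively_invariant_def region_of_attraction_def R_def)
  qed
qed

end
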